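(* Let $n\ge2$ and let $\varphi:\mathcal{T}_n\to\mathbf{R}_+^*\times\mathbf{D}^{n-1}$, $R_n\mapsto(P_0,\mu_1,\dots,\mu_{n-1})$, be the reflection coefficient map defined in the context. Then $\varphi$ is a diffeomorphism, whose explicit expression is $P_0=r_0$ and $$\mu_k=(-1)^k\frac{\det S_k}{\det R_k},\qquad 1\le k\le n-1,$$ where $S_k=R_{k+1}\binom{2,\dots,k+1}{1,\dots,k}$ is the submatrix of $R_{k+1}$ obtained by deleting the first row and the last column. On the other hand, if $(P_0,\mu_1,\dots,\mu_{n-1})\in\mathbf{R}_+^*\times\mathbf{D}^{n-1}$, then its inverse image $R_n$ under $\varphi$ can be calculated by the following algorithm: $$r_0=P_0,\qquad r_1=-P_0\mu_1,$$ $$r_k=-\mu_kP_{k-1}+\alpha_{k-1}^TJ_{k-1}R_{k-1}^{-1}\alpha_{k-1},\qquad 2\le k\le n-1,$$ where $\alpha_{k-1}=(r_1,\dots,r_{k-1})^T$, $J_{k-1}$ is the $(k-1)\times(k-1)$ matrix with ones on the antidiagonal and zeros elsewhere, and $P_{k-1}=P_0\prod_{i=1}^{k-1}(1-|\mu_i|^2)$.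
   Context: $\mathcal{T}_n$ is the set of $n\times n$ Toeplitz Hermitian positive definite matrices, viewed as an open submanifold of $\mathbf{R}^{2n-1}$. An element $R_n\in\mathcal{T}_n$ is written with entries $(R_n)_{ij}=r_{i-j}$ for $i\ge j$ and $(R_n)_{ij}=\overline{r}_{j-i}$ for $i<j$ (so $r_0>0$, and the first column is $(r_0,\dots,r_{n-1})^T$). $R_k$ denotes the upper left $k\times k$ corner of $R_n$. For $1\le k\le n-1$ the Yule-Walker equation is $R_{k+1}(1,a_1^{(k)},\dots,a_k^{(k)})^T=(P_k,0,\dots,0)^T$, with $P_k=\det R_{k+1}/\det R_k$; the $k$-th reflection coefficient is $\mu_k:=a_k^{(k)}$, and it satisfies $|\mu_k|<1$. Put $P_0=r_0$, $\mathbf{D}=\{z\in\mathbf{C}:|z|<1\}$, $\mathbf{R}_+^*=(0,\infty)$, and $\varphi(R_n)=(P_0,\mu_1,\dots,\mu_{n-1})$. *)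

theory Defs
  imports "HOL-Analysis.Analysis" "Jordan_Normal_Form.Schur_Decomposition"
begin

(* Both matrix libraries claim the symbol $; from here on it denotes components of 'a^'m. *)
no_notation vec_index (infixl "$" 100)


section \<open>Smooth maps and diffeomorphisms between open sets\<close>

text \<open>Only meaningful on open \<open>S\<close>, because derivatives are taken in full neighbourhoods. In finite
  dimension, level \<open>k\<close> is the class $C^k$ over the reals.\<close>

primrec higher_differentiable_on ::
    "nat \<Rightarrow> 'a::real_normed_vector set \<Rightarrow> ('a \<Rightarrow> 'b::real_normed_vector) \<Rightarrow> bool" where
  "higher_differentiable_on 0 S f \<longleftrightarrow> continuous_on S f"
| "higher_differentiable_on (Suc k) S f \<longleftrightarrow>
     (\<forall>x\<in>S. f differentiable (at x)) \<and>
     (\<forall>v. higher_differentiable_on k S (\<lambda>x. frechet_derivative f (at x) v))"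

definition smooth_on ::
    "'a::real_normed_vector set \<Rightarrow> ('a \<Rightarrow> 'b::real_normed_vector) \<Rightarrow> bool" where
  "smooth_on S f \<longleftrightarrow> (\<forall>k. higher_differentiable_on k S f)"

definition diffeomorphism ::
    "'a::real_normed_vector set \<Rightarrow> 'b::real_normed_vector set \<Rightarrow> ('a \<Rightarrow> 'b) \<Rightarrow> bool" where
  "diffeomorphism S T f \<longleftrightarrow>
     open S \<and> open T \<and> bij_betw f S T \<and> smooth_on S f \<and> smooth_on T (inv_into S f)"


section \<open>Toeplitz Hermitian positive definite matrices\<close>

definition toeplitz :: "complex mat \<Rightarrow> bool" where
  "toeplitz A \<longleftrightarrow> (\<forall>i j. Suc i < dim_row A \<longrightarrow> Suc j < dim_col A \<longrightarrow> A $$ (Suc i, Suc j) = A $$ (i, j))"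

definition hermitian :: "complex mat \<Rightarrow> bool" where
  "hermitian A \<longleftrightarrow> mat_adjoint A = A"

definition positive_definite :: "complex mat \<Rightarrow> bool" where
  "positive_definite A \<longleftrightarrow>
     (\<forall>v\<in>carrier_vec (dim_col A). v \<noteq> 0\<^sub>v (dim_col A) \<longrightarrow> 0 < Re ((A *\<^sub>v v) \<bullet>c v))"

definition toeplitz_hpd :: "nat \<Rightarrow> complex mat set" where
  "toeplitz_hpd n = {A \<in> carrier_mat n n. toeplitz A \<and> hermitian A \<and> positive_definite A}"

definition corner :: "complex mat \<Rightarrow> nat \<Rightarrow> complex mat" where
  "corner A k = mat k k (\<lambda>ij. A $$ ij)"

text \<open>The identification of Hermitian Toeplitz $n \times n$ matrices with
  $\mathbf{R}^{2n-1} = \mathbf{R} \times \mathbf{C}^{n-1}$. The $n - 1$ complex coordinates are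
  indexed by a finite type, listed as \<open>e 1, \<dots>, e (n - 1)\<close> by a bijection \<open>e\<close>
  of \<open>{1..n-1}\<close> onto that type.\<close>

definition toeplitz_coeff :: "(nat \<Rightarrow> 'm::finite) \<Rightarrow> real \<times> (complex^'m) \<Rightarrow> nat \<Rightarrow> complex" where
  "toeplitz_coeff e x k = (if k = 0 then complex_of_real (fst x) else snd x $ e k)"

definition toeplitz_matrix :: "nat \<Rightarrow> (nat \<Rightarrow> 'm::finite) \<Rightarrow> real \<times> (complex^'m) \<Rightarrow> complex mat" where
  "toeplitz_matrix n e x =
     mat n n (\<lambda>(i, j). if j \<le> i then toeplitz_coeff e x (i - j) else cnj (toeplitz_coeff e x (j - i)))"

definition toeplitz_domain :: "nat \<Rightarrow> (nat \<Rightarrow> 'm::finite) \<Rightarrow> (real \<times> (complex^'m)) set" where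
  "toeplitz_domain n e = {x. toeplitz_matrix n e x \<in> toeplitz_hpd n}"

lemma hermitian_iff:
  assumes "A \<in> carrier_mat n n"
  shows "hermitian A \<longleftrightarrow> (\<forall>i<n. \<forall>j<n. A $$ (i, j) = cnj (A $$ (j, i)))"
proof -
  have *: "mat_adjoint A \<in> carrier_mat n n"
    using assms by (auto simp: mat_adjoint_def)
  have **: "mat_adjoint A $$ (i, j) = cnj (A $$ (j, i))" if "i < n" "j < n" for i j
    using assms that by (auto simp: mat_adjoint_def mat_of_rows_def)
  show ?thesis
    unfolding hermitian_def
  proof
    assume "mat_adjoint A = A"
    then show "\<forall>i<n. \<forall>j<n. A $$ (i, j) = cnj (A $$ (j, i))" using ** by metis
  next
    assume sym: "\<forall>i<n. \<forall>j<n. A $$ (i, j) = cnj (A $$ (j, i))"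
    show "mat_adjoint A = A"
    proof (rule eq_matI)
      fix i j assume "i < dim_row A" "j < dim_col A"
      then show "mat_adjoint A $$ (i, j) = A $$ (i, j)"
        using ** sym assms by (metis carrier_matD)
    qed (use * assms in \<open>metis carrier_matD\<close>)+
  qed
qed

lemma toeplitz_shift:
  assumes "toeplitz A" "A \<in> carrier_mat n n" "i + d < n" "j + d < n"
  shows "A $$ (i + d, j + d) = A $$ (i, j)"
  using assms(3,4)
proof (induction d)
  case (Suc d)
  then show ?case using assms(1,2) by (auto simp: toeplitz_def)
qed simp

lemma bij_betw_toeplitz_matrix:
  assumes "2 \<le> n" and e: "bij_betw e {1..n - 1} (UNIV :: 'm::finite set)"
  shows "bij_betw (toeplitz_matrix n e) (toeplitz_domain n e) (toeplitz_hpd n)"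
proof (rule bij_betw_imageI)
  have first: "toeplitz_matrix n e x $$ (k, 0) = toeplitz_coeff e x k" if "k < n" for x k
    using that by (simp add: toeplitz_matrix_def)
  show "inj_on (toeplitz_matrix n e) (toeplitz_domain n e)"
  proof (rule inj_onI)
    fix x y assume eq: "toeplitz_matrix n e x = toeplitz_matrix n e y"
    have c: "toeplitz_coeff e x k = toeplitz_coeff e y k" if "k < n" for k
      using first[OF that, of x] first[OF that, of y] eq by simp
    have "fst x = fst y" using c[of 0] assms(1) by (simp add: toeplitz_coeff_def)
    moreover have "snd x $ i = snd y $ i" for i
    proof -
      obtain k where k: "k \<in> {1..n - 1}" "i = e k"
        using e by (metis UNIV_I bij_betw_imp_surj_on imageE)
      with c[of k] show ?thesis by (auto simp: toeplitz_coeff_def)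
    qed
    ultimately show "x = y" by (simp add: prod_eq_iff Finite_Cartesian_Product.vec_eq_iff)
  qed
  show "toeplitz_matrix n e ` toeplitz_domain n e = toeplitz_hpd n"
  proof
    show "toeplitz_matrix n e ` toeplitz_domain n e \<subseteq> toeplitz_hpd n"
      by (auto simp: toeplitz_domain_def)
    show "toeplitz_hpd n \<subseteq> toeplitz_matrix n e ` toeplitz_domain n e"
    proof
      fix A assume A: "A \<in> toeplitz_hpd n"
      then have carr: "A \<in> carrier_mat n n" and toep: "toeplitz A" and herm: "hermitian A"
        by (auto simp: toeplitz_hpd_def)
      note sym = herm[unfolded hermitian_iff[OF carr], rule_format]
      define x :: "real \<times> (complex^'m)" where
        "x = (Re (A $$ (0, 0)), \<chi> i. A $$ (inv_into {1..n - 1} e i, 0))"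
      have real0: "complex_of_real (Re (A $$ (0, 0))) = A $$ (0, 0)"
        using arg_cong[where f = Im, OF sym[of 0 0]] assms(1) by (simp add: complex_eq_iff)
      have coeff: "toeplitz_coeff e x k = A $$ (k, 0)" if "k < n" for k
        using that real0 e
        by (auto simp: toeplitz_coeff_def x_def bij_betw_def intro!: arg_cong[of _ _ "\<lambda>k. A $$ (k, 0)"] inv_into_f_f)
      have low: "A $$ (i, j) = A $$ (i - j, 0)" if "j \<le> i" "i < n" for i j
        using toeplitz_shift[OF toep carr, of "i - j" j 0] that by simp
      have "toeplitz_matrix n e x = A"
      proof (rule eq_matI)
        fix i j assume "i < dim_row A" "j < dim_col A"
        then have ij: "i < n" "j < n" using carr by auto
        show "toeplitz_matrix n e x $$ (i, j) = A $$ (i, j)"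
        proof (cases "j \<le> i")
          case True
          then show ?thesis using ij low[of j i] by (simp add: toeplitz_matrix_def coeff)
        next
          case False
          then show ?thesis
            using ij low[of i j] sym[of i j] by (simp add: toeplitz_matrix_def coeff)
        qed
      qed (use carr in \<open>auto simp: toeplitz_matrix_def\<close>)
      then show "A \<in> toeplitz_matrix n e ` toeplitz_domain n e"
        using A by (metis (mono_tags) image_eqI mem_Collect_eq toeplitz_domain_def)
    qed
  qed
qed


section \<open>The reflection coefficient map\<close>

definition prediction_error :: "complex mat \<Rightarrow> nat \<Rightarrow> complex" where
  "prediction_error A k = Determinant.det (corner A (Suc k)) / Determinant.det (corner A k)"

text \<open>The vector $(1, a_1^{(k)}, \dots, a_k^{(k)})^T$ solving the Yule-Walker equation.\<close>

definition yule_walker :: "complex mat \<Rightarrow> nat \<Rightarrow> complex Matrix.vec" where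
  "yule_walker A k = (THE v. v \<in> carrier_vec (Suc k) \<and> vec_index v 0 = 1 \<and>
     corner A (Suc k) *\<^sub>v v = prediction_error A k \<cdot>\<^sub>v unit_vec (Suc k) 0)"

definition reflection_coeff :: "complex mat \<Rightarrow> nat \<Rightarrow> complex" where
  "reflection_coeff A k = vec_index (yule_walker A k) k"

definition reflection_map ::
    "nat \<Rightarrow> (nat \<Rightarrow> 'm::finite) \<Rightarrow> real \<times> (complex^'m) \<Rightarrow> real \<times> (complex^'m)" where
  "reflection_map n e x =
     (fst x, \<chi> i. reflection_coeff (toeplitz_matrix n e x) (inv_into {1..n - 1} e i))"

definition reflection_codomain :: "(real \<times> (complex^'m::finite)) set" where
  "reflection_codomain = {0<..} \<times> {\<mu>. \<forall>i. cmod (\<mu> $ i) < 1}"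


section \<open>Ingredients of the inversion algorithm\<close>

definition coeff_vec :: "(nat \<Rightarrow> complex) \<Rightarrow> nat \<Rightarrow> complex Matrix.vec" where
  "coeff_vec r m = Matrix.vec m (\<lambda>i. r (Suc i))"

definition exchange_mat :: "nat \<Rightarrow> complex mat" where
  "exchange_mat m = Matrix.mat m m (\<lambda>(i, j). if i + j + 1 = m then 1 else 0)"

definition reflection_error :: "(nat \<Rightarrow> 'm::finite) \<Rightarrow> real \<times> (complex^'m) \<Rightarrow> nat \<Rightarrow> real" where
  "reflection_error e p k = fst p * (\<Prod>i = 1..k. 1 - (cmod (snd p $ e i))\<^sup>2)"

end

theory Submission
  imports Defs
begin

text \<open>
  Everything rests on the Levinson recursion. Write \<open>a\<close> for the vector that solves the Yule-Walker
  equation of order \<open>k\<close>, with error \<open>P\<close>, for a Hermitian Toeplitz matrix. Reversing the order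
  of both rows and columns conjugates the matrix, so the reversed conjugate of \<open>a\<close> solves the equation that
  has \<open>P\<close> in the last row. The solution of order \<open>k + 1\<close> is therefore \<open>a\<close> plus \<open>\<mu>\<close> times this
  reversed vector shifted by one, where \<open>\<mu>\<close> is fixed by one linear equation linking \<open>\<mu>\<close>, \<open>P\<close> and
  the new coefficient \<open>r (k + 1)\<close>, and the error becomes \<open>P (1 - |\<mu>|\<^sup>2)\<close>
  (\<open>yule_walker_sol_levinson_step\<close>).

  Reading that equation from \<open>\<mu>\<close> to \<open>r\<close> yields the inverse map: the solutions, the errors and
  the coefficients \<open>r k\<close> are polynomials in \<open>P\<^sub>0\<close>, the \<open>\<mu> i\<close> and their conjugates
  (\<open>levinson_poly\<close>, \<open>levinson_error\<close>, \<open>levinson_coeff\<close>), so the inverse is smooth. Reading it from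
  \<open>r\<close> to \<open>\<mu>\<close> shows that the coefficients of a positive definite matrix arise in this way from its
  own reflection coefficients (\<open>toeplitz_coeff_reflection_map\<close>).

  That the two domains correspond is a Schur complement argument. The Yule-Walker solution diagonalises
  the form one step at a time: the form of size \<open>k + 1\<close> is \<open>P |v\<^sub>0|\<^sup>2\<close> plus the form of size \<open>k\<close>
  in shifted variables (\<open>toep_form_split\<close>). Hence positivity passes from size \<open>k\<close> to size \<open>k + 1\<close>
  exactly when \<open>P > 0\<close>, and since the errors are \<open>P\<^sub>0 \<Prod> (1 - |\<mu> i|\<^sup>2)\<close>, this means \<open>P\<^sub>0 > 0\<close> and all
  \<open>|\<mu> i| < 1\<close>.

  Cramer's rule applied to the Yule-Walker equation gives \<open>P\<close> and \<open>\<mu>\<close> as quotients of determinants,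
  whence the explicit formula and the smoothness of the map itself. The quadratic expression in the
  algorithm is minus the sum over \<open>j \<ge> 1\<close> in the Levinson equation, because \<open>- R\<inverse> \<alpha>\<close> is the tail of the
  Yule-Walker solution (\<open>exchange_form\<close>).
\<close>

section \<open>Calculus of smooth maps\<close>

lemma higher_differentiable_on_cong:
  assumes "open S" "higher_differentiable_on k S f" "\<And>x. x \<in> S \<Longrightarrow> f x = g x"
  shows "higher_differentiable_on k S g"
  using assms(2,3)
proof (induction k arbitrary: f g)
  case 0
  then show ?case by (auto cong: continuous_on_cong)
next
  case (Suc k)
  have der: "(g has_derivative frechet_derivative f (at x)) (at x)" if "x \<in> S" for x
    using Suc.prems that \<open>open S\<close>
    by (auto simp: frechet_derivative_works intro!: has_derivative_transform_within_open[of f _ x UNIV S g])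
  show ?case
    unfolding higher_differentiable_on.simps(2)
  proof (intro conjI ballI allI)
    show "g differentiable at x" if "x \<in> S" for x
      using der[OF that] by (rule differentiableI)
    show "higher_differentiable_on k S (\<lambda>x. frechet_derivative g (at x) v)" for v
      by (rule Suc.IH[of "\<lambda>x. frechet_derivative f (at x) v"])
        (use Suc.prems(1) frechet_derivative_at[OF der] in auto)
  qed
qed

text \<open>The recursive definition speaks of \<open>frechet_derivative\<close>; this rule lets every closure property
  below supply its own formula for the derivative instead.\<close>

lemma higher_differentiable_on_SucI:
  assumes "open S" "\<And>x. x \<in> S \<Longrightarrow> (f has_derivative f' x) (at x)"
    "\<And>v. higher_differentiable_on k S (\<lambda>x. f' x v)"
  shows "higher_differentiable_on (Suc k) S f"
  unfolding higher_differentiable_on.simps(2)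
proof (intro conjI ballI allI)
  show "f differentiable at x" if "x \<in> S" for x
    using assms(2)[OF that] by (rule differentiableI)
  show "higher_differentiable_on k S (\<lambda>x. frechet_derivative f (at x) v)" for v
    by (rule higher_differentiable_on_cong[OF assms(1) assms(3)[of v]])
      (simp add: frechet_derivative_at[OF assms(2)])
qed

lemma higher_differentiable_on_SucD:
  assumes "higher_differentiable_on (Suc k) S f"
  shows "higher_differentiable_on k S f"
  using assms
proof (induction k arbitrary: f)
  case 0
  then show ?case
    by (auto intro!: continuous_at_imp_continuous_on differentiable_imp_continuous_within)
qed auto

lemma higher_differentiable_on_has_derivative:
  assumes "higher_differentiable_on (Suc k) S f" "x \<in> S"
  shows "(f has_derivative frechet_derivative f (at x)) (at x)"
  using assms by (auto simp: frechet_derivative_works)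

lemma higher_differentiable_on_const: "open S \<Longrightarrow> higher_differentiable_on k S (\<lambda>x. c)"
proof (induction k arbitrary: c)
  case (Suc k)
  then show ?case
    by (intro higher_differentiable_on_SucI[where f' = "\<lambda>x v. 0"]) auto
qed auto

lemma higher_differentiable_on_id: "open S \<Longrightarrow> higher_differentiable_on k S (\<lambda>x. x)"
proof (cases k)
  case (Suc l)
  then show "open S \<Longrightarrow> ?thesis"
    using higher_differentiable_on_SucI[where f' = "\<lambda>x v. v"] higher_differentiable_on_const
    by (metis has_derivative_ident)
qed auto

lemma higher_differentiable_on_bounded_linear:
  assumes "bounded_linear h" "open S" "higher_differentiable_on k S f"
  shows "higher_differentiable_on k S (\<lambda>x. h (f x))"
  using assms(3)
proof (induction k arbitrary: f)
  case 0
  then show ?case using assms(1) by (auto intro: bounded_linear.continuous_on)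
next
  case (Suc k)
  show ?case
    by (rule higher_differentiable_on_SucI[OF \<open>open S\<close>],
        rule bounded_linear.has_derivative[OF assms(1) higher_differentiable_on_has_derivative[OF Suc.prems]])
      (use Suc in auto)
qed

lemma higher_differentiable_on_add:
  assumes "open S" "higher_differentiable_on k S f" "higher_differentiable_on k S g"
  shows "higher_differentiable_on k S (\<lambda>x. f x + g x)"
  using assms(2,3)
proof (induction k arbitrary: f g)
  case 0
  then show ?case by (auto intro: continuous_on_add)
next
  case (Suc k)
  show ?case
    by (rule higher_differentiable_on_SucI[OF \<open>open S\<close>],
        rule has_derivative_add[OF higher_differentiable_on_has_derivative[OF Suc.prems(1)]
          higher_differentiable_on_has_derivative[OF Suc.prems(2)]])
      (use Suc in auto)
qed

text \<open>By the product rule the derivative is a sum of products of a factor with a derivative of the other.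
  The factors enter one level lower than they are given, hence the appeal to
  \<open>higher_differentiable_on_SucD\<close>.\<close>

lemma higher_differentiable_on_mult:
  fixes f g :: "'a::real_normed_vector \<Rightarrow> 'b::real_normed_algebra"
  assumes "open S" "higher_differentiable_on k S f" "higher_differentiable_on k S g"
  shows "higher_differentiable_on k S (\<lambda>x. f x * g x)"
  using assms(2,3)
proof (induction k arbitrary: f g)
  case 0
  then show ?case by (auto intro: continuous_on_mult)
next
  case (Suc k)
  have lower: "higher_differentiable_on k S f" "higher_differentiable_on k S g"
    using Suc.prems[THEN higher_differentiable_on_SucD] .
  show ?case
    by (rule higher_differentiable_on_SucI[OF \<open>open S\<close>],
        rule has_derivative_mult[OF higher_differentiable_on_has_derivative[OF Suc.prems(1)]
          higher_differentiable_on_has_derivative[OF Suc.prems(2)]])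
      (use Suc lower in \<open>auto intro!: higher_differentiable_on_add \<open>open S\<close>\<close>)
qed

text \<open>The derivative \<open>- f\<inverse> f' f\<inverse>\<close> contains \<open>f\<inverse>\<close> again, one level lower, so induction on the
  level closes up.\<close>

lemma higher_differentiable_on_inverse:
  fixes f :: "'a::real_normed_vector \<Rightarrow> 'b::real_normed_field"
  assumes "open S" "higher_differentiable_on k S f" "\<And>x. x \<in> S \<Longrightarrow> f x \<noteq> 0"
  shows "higher_differentiable_on k S (\<lambda>x. inverse (f x))"
  using assms(2)
proof (induction k)
  case 0
  then show ?case using assms(3) by (auto intro: continuous_on_inverse)
next
  case (Suc k)
  have "higher_differentiable_on k S (\<lambda>x. inverse (f x))"
    using Suc.IH higher_differentiable_on_SucD[OF Suc.prems] .
  moreover have "higher_differentiable_on k S (\<lambda>x. frechet_derivative f (at x) v)" for v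
    using Suc.prems by simp
  ultimately have der: "higher_differentiable_on k S
      (\<lambda>x. - (inverse (f x) * frechet_derivative f (at x) v * inverse (f x)))" for v
    using \<open>open S\<close>
    by (auto intro!: higher_differentiable_on_mult higher_differentiable_on_bounded_linear[OF bounded_linear_minus[OF bounded_linear_ident]])
  show ?case
    by (rule higher_differentiable_on_SucI[OF \<open>open S\<close>],
        rule Deriv.has_derivative_inverse[OF _ higher_differentiable_on_has_derivative[OF Suc.prems]])
      (use assms(3) der in auto)
qed

context
  fixes S :: "'a::real_normed_vector set"
  assumes S: "open S"
begin

lemma smooth_on_cong:
  "smooth_on S f \<Longrightarrow> (\<And>x. x \<in> S \<Longrightarrow> f x = g x) \<Longrightarrow> smooth_on S g"
  unfolding smooth_on_def using higher_differentiable_on_cong[OF S] by blast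

lemma smooth_on_const: "smooth_on S (\<lambda>x. c)"
  unfolding smooth_on_def using higher_differentiable_on_const[OF S] by blast

lemma smooth_on_id: "smooth_on S (\<lambda>x. x)"
  unfolding smooth_on_def using higher_differentiable_on_id[OF S] by blast

lemma smooth_on_bounded_linear:
  "bounded_linear h \<Longrightarrow> smooth_on S f \<Longrightarrow> smooth_on S (\<lambda>x. h (f x))"
  unfolding smooth_on_def using higher_differentiable_on_bounded_linear[OF _ S] by blast

lemma smooth_on_add:
  "smooth_on S f \<Longrightarrow> smooth_on S g \<Longrightarrow> smooth_on S (\<lambda>x. f x + g x)"
  unfolding smooth_on_def using higher_differentiable_on_add[OF S] by blast

lemma smooth_on_uminus: "smooth_on S f \<Longrightarrow> smooth_on S (\<lambda>x. - f x)"
  by (rule smooth_on_bounded_linear[OF bounded_linear_minus[OF bounded_linear_ident]])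

lemma smooth_on_diff:
  "smooth_on S f \<Longrightarrow> smooth_on S g \<Longrightarrow> smooth_on S (\<lambda>x. f x - g x)"
  using smooth_on_add[of f "\<lambda>x. - g x"] smooth_on_uminus by auto

lemma smooth_on_cnj: "smooth_on S f \<Longrightarrow> smooth_on S (\<lambda>x. cnj (f x))"
  by (rule smooth_on_bounded_linear[OF bounded_linear_cnj])

lemma smooth_on_mult:
  fixes f g :: "'a \<Rightarrow> 'b::real_normed_algebra"
  shows "smooth_on S f \<Longrightarrow> smooth_on S g \<Longrightarrow> smooth_on S (\<lambda>x. f x * g x)"
  unfolding smooth_on_def using higher_differentiable_on_mult[OF S] by blast

lemma smooth_on_divide:
  fixes f g :: "'a \<Rightarrow> 'b::real_normed_field"
  assumes "smooth_on S f" "smooth_on S g" "\<And>x. x \<in> S \<Longrightarrow> g x \<noteq> 0"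
  shows "smooth_on S (\<lambda>x. f x / g x)"
  using assms higher_differentiable_on_inverse[OF S, of _ g]
  unfolding divide_inverse by (intro smooth_on_mult) (auto simp: smooth_on_def)

lemma smooth_on_sum:
  "(\<And>i. i \<in> I \<Longrightarrow> smooth_on S (f i)) \<Longrightarrow> smooth_on S (\<lambda>x. \<Sum>i\<in>I. f i x)"
  by (induction I rule: infinite_finite_induct) (auto intro: smooth_on_const smooth_on_add)

lemma smooth_on_prod:
  fixes f :: "'i \<Rightarrow> 'a \<Rightarrow> 'b::{real_normed_algebra, comm_ring_1}"
  shows "(\<And>i. i \<in> I \<Longrightarrow> smooth_on S (f i)) \<Longrightarrow> smooth_on S (\<lambda>x. \<Prod>i\<in>I. f i x)"
  by (induction I rule: infinite_finite_induct) (auto intro: smooth_on_const smooth_on_mult)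

lemma smooth_on_Pair:
  assumes "smooth_on S f" "smooth_on S g"
  shows "smooth_on S (\<lambda>x. (f x, g x))"
proof -
  have "bounded_linear (\<lambda>y. (y, 0 :: 'c))" "bounded_linear (\<lambda>y. (0 :: 'b, y))"
    by (auto intro: bounded_linear_Pair bounded_linear_ident bounded_linear_zero)
  from smooth_on_add[OF smooth_on_bounded_linear[OF this(1) assms(1)]
      smooth_on_bounded_linear[OF this(2) assms(2)]]
  show ?thesis by simp
qed

lemma smooth_on_vec_lambda:
  fixes f :: "'m::finite \<Rightarrow> 'a \<Rightarrow> 'b::real_normed_vector"
  assumes "\<And>i. smooth_on S (f i)"
  shows "smooth_on S (\<lambda>x. \<chi> i. f i x)"
proof -
  have "bounded_linear (\<lambda>y :: 'b. axis i y :: 'b^'m)" for i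
  proof (rule bounded_linear_intro[where K = 1])
    fix y :: 'b
    have "norm (axis i y :: 'b^'m) \<le> (\<Sum>j\<in>UNIV. norm ((axis i y :: 'b^'m) $ j))"
      unfolding norm_vec_def by (rule L2_set_le_sum) simp
    also have "\<dots> = (\<Sum>j\<in>UNIV. if j = i then norm y else 0)"
      by (intro sum.cong) (auto simp: axis_def)
    finally show "norm (axis i y :: 'b^'m) \<le> norm y * 1" by simp
  qed (auto simp: axis_def Finite_Cartesian_Product.vec_eq_iff)
  from smooth_on_bounded_linear[OF this assms]
  have "smooth_on S (\<lambda>x. \<Sum>i\<in>UNIV. (axis i (f i x) :: 'b^'m))"
    by (rule smooth_on_sum)
  moreover have "(\<Sum>i\<in>UNIV. (axis i (f i x) :: 'b^'m)) = (\<chi> i. f i x)" for x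
    by (auto simp: axis_def Finite_Cartesian_Product.vec_eq_iff if_distrib cong: if_cong)
  ultimately show ?thesis by simp
qed

lemma smooth_on_det:
  fixes M :: "'a \<Rightarrow> complex mat"
  assumes "\<And>x. M x \<in> carrier_mat n n"
    "\<And>i j. i < n \<Longrightarrow> j < n \<Longrightarrow> smooth_on S (\<lambda>x. M x $$ (i, j))"
  shows "smooth_on S (\<lambda>x. Determinant.det (M x))"
  unfolding det_def'[OF assms(1)]
proof (intro smooth_on_sum smooth_on_mult smooth_on_prod smooth_on_const assms(2))
  fix p i assume "p \<in> {p. p permutes {0..<n}}" "i \<in> {0..<n}"
  then show "i < n" "p i < n" using permutes_in_image[of p "{0..<n}" i] by auto
qed

end

section \<open>Toeplitz forms and the Levinson step\<close>

text \<open>The symbol \<open>r\<close> is a sequence on all of \<open>nat\<close>, so that the matrices of all sizes are corners of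
  the same infinite one.\<close>

definition toep :: "(nat \<Rightarrow> complex) \<Rightarrow> nat \<Rightarrow> nat \<Rightarrow> complex" where
  "toep r i j = (if j \<le> i then r (i - j) else cnj (r (j - i)))"

text \<open>Vectors are functions on \<open>nat\<close> of which only the first \<open>k\<close> values matter. This avoids dimension
  bookkeeping when passing from size \<open>k\<close> to \<open>k + 1\<close>.\<close>

definition toep_pd :: "(nat \<Rightarrow> complex) \<Rightarrow> nat \<Rightarrow> bool" where
  "toep_pd r k \<longleftrightarrow> (\<forall>v. (\<exists>i<k. v i \<noteq> 0) \<longrightarrow>
     0 < Re (\<Sum>i<k. \<Sum>j<k. cnj (v i) * toep r i j * v j))"

text \<open>The error \<open>P\<close> is a parameter and not a quotient of determinants; that it equals this quotient is a
  consequence (\<open>det_toep_mat_Suc\<close>).\<close>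

definition yule_walker_sol :: "(nat \<Rightarrow> complex) \<Rightarrow> nat \<Rightarrow> (nat \<Rightarrow> complex) \<Rightarrow> complex \<Rightarrow> bool" where
  "yule_walker_sol r k a P \<longleftrightarrow>
     a 0 = 1 \<and> (\<forall>i\<le>k. (\<Sum>j\<le>k. toep r i j * a j) = (if i = 0 then P else 0))"

lemma toep_Suc_Suc [simp]: "toep r (Suc i) (Suc j) = toep r i j"
  by (simp add: toep_def)

lemma cnj_toep: "cnj (r 0) = r 0 \<Longrightarrow> cnj (toep r i j) = toep r j i"
  by (auto simp: toep_def)

lemma toep_reflect: "i \<le> n \<Longrightarrow> j \<le> n \<Longrightarrow> toep r (n - i) (n - j) = toep r j i"
  by (auto simp: toep_def)

text \<open>Vectors of the smaller size are padded with zeros.\<close>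

lemma toep_pd_mono:
  assumes "toep_pd r m" "k \<le> m"
  shows "toep_pd r k"
  unfolding toep_pd_def
proof (intro allI impI)
  fix v :: "nat \<Rightarrow> complex"
  assume "\<exists>i<k. v i \<noteq> 0"
  define w where "w i = (if i < k then v i else 0)" for i
  have "\<exists>i<m. w i \<noteq> 0"
    using \<open>\<exists>i<k. v i \<noteq> 0\<close> assms(2) by (auto simp: w_def intro: less_le_trans)
  then have "0 < Re (\<Sum>i<m. \<Sum>j<m. cnj (w i) * toep r i j * w j)"
    using assms(1) by (auto simp: toep_pd_def)
  also have "(\<Sum>i<m. \<Sum>j<m. cnj (w i) * toep r i j * w j) = (\<Sum>i<k. \<Sum>j<k. cnj (w i) * toep r i j * w j)"
    using assms(2)
    by (intro sum.mono_neutral_cong_right) (auto simp: w_def intro!: sum.mono_neutral_cong_right sum.neutral)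
  also have "\<dots> = (\<Sum>i<k. \<Sum>j<k. cnj (v i) * toep r i j * v j)"
    by (simp add: w_def)
  finally show "0 < Re (\<Sum>i<k. \<Sum>j<k. cnj (v i) * toep r i j * v j)" .
qed

text \<open>Put \<open>w = v - v\<^sub>0 a\<close>, so that \<open>w\<^sub>0 = 0\<close>. Since \<open>T a\<close> is a multiple of the first unit vector, \<open>a\<close>
  and \<open>w\<close> are orthogonal for the form. The form at \<open>a\<close> is \<open>P\<close>, and the form at \<open>w\<close> involves only
  the lower right corner of the matrix, which by the Toeplitz property is the upper left one.\<close>

lemma toep_form_split:
  assumes "yule_walker_sol r k a P" "cnj (r 0) = r 0"
  shows "(\<Sum>i\<le>k. \<Sum>j\<le>k. cnj (v i) * toep r i j * v j) =
    cnj (v 0) * v 0 * P +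
    (\<Sum>i<k. \<Sum>j<k. cnj (v (Suc i) - v 0 * a (Suc i)) * toep r i j * (v (Suc j) - v 0 * a (Suc j)))"
proof -
  define w where "w i = v i - v 0 * a i" for i
  have a0: "a 0 = 1" and yw: "\<And>i. i \<le> k \<Longrightarrow> (\<Sum>j\<le>k. toep r i j * a j) = (if i = 0 then P else 0)"
    using assms(1) by (auto simp: yule_walker_sol_def)
  have w0: "w 0 = 0" by (simp add: w_def a0)
  have v: "v i = v 0 * a i + w i" for i by (simp add: w_def)
  define W where "W i = (\<Sum>j\<le>k. toep r i j * w j)" for i
  have row: "(\<Sum>j\<le>k. toep r i j * v j) = (if i = 0 then v 0 * P else 0) + W i" if "i \<le> k" for i
  proof -
    have "(\<Sum>j\<le>k. toep r i j * v j) = v 0 * (\<Sum>j\<le>k. toep r i j * a j) + W i"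
      unfolding W_def sum_distrib_left sum.distrib[symmetric]
      by (intro sum.cong refl) (subst v, simp add: algebra_simps)
    then show ?thesis using yw[OF that] by simp
  qed
  have orth: "(\<Sum>i\<le>k. cnj (a i) * W i) = 0"
  proof -
    have "(\<Sum>i\<le>k. cnj (a i) * W i) = (\<Sum>j\<le>k. \<Sum>i\<le>k. cnj (a i) * (toep r i j * w j))"
      unfolding W_def sum_distrib_left by (rule sum.swap)
    also have "\<dots> = (\<Sum>j\<le>k. w j * cnj (\<Sum>i\<le>k. toep r j i * a i))"
      by (simp add: sum_distrib_left cnj_toep[of r, OF assms(2)] mult_ac)
    also have "\<dots> = (\<Sum>j\<le>k. 0)"
      by (intro sum.cong refl) (auto simp: yw w0)
    finally show ?thesis by simp
  qed
  have "(\<Sum>i\<le>k. \<Sum>j\<le>k. cnj (v i) * toep r i j * v j) = (\<Sum>i\<le>k. cnj (v i) * (\<Sum>j\<le>k. toep r i j * v j))"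
    by (simp add: sum_distrib_left mult.assoc)
  also have "\<dots> = (\<Sum>i\<le>k. (if i = 0 then cnj (v 0) * v 0 * P else 0) + cnj (v i) * W i)"
  proof (intro sum.cong refl)
    fix i assume "i \<in> {..k}"
    then show "cnj (v i) * (\<Sum>j\<le>k. toep r i j * v j) =
        (if i = 0 then cnj (v 0) * v 0 * P else 0) + cnj (v i) * W i"
      by (subst row) (simp_all add: algebra_simps)
  qed
  also have "\<dots> = cnj (v 0) * v 0 * P + (\<Sum>i\<le>k. cnj (v i) * W i)"
    by (simp add: sum.distrib)
  also have "(\<Sum>i\<le>k. cnj (v i) * W i) = cnj (v 0) * (\<Sum>i\<le>k. cnj (a i) * W i) + (\<Sum>i\<le>k. cnj (w i) * W i)"
    unfolding sum_distrib_left sum.distrib[symmetric]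
    by (intro sum.cong refl) (simp add: w_def algebra_simps)
  also have "(\<Sum>i\<le>k. cnj (w i) * W i) = (\<Sum>i<k. \<Sum>j<k. cnj (w (Suc i)) * toep r i j * w (Suc j))"
    by (simp add: W_def sum.atMost_shift w0 sum_distrib_left mult.assoc)
  finally show ?thesis by (simp add: orth w_def)
qed

lemma toep_pd_Suc_iff:
  assumes "toep_pd r k" "yule_walker_sol r k a (complex_of_real P)" "cnj (r 0) = r 0"
  shows "toep_pd r (Suc k) \<longleftrightarrow> 0 < P"
proof
  have a0: "a 0 = 1" using assms(2) by (simp add: yule_walker_sol_def)
  note split = toep_form_split[OF assms(2,3)]
  {
    assume "toep_pd r (Suc k)"
    then have "0 < Re (\<Sum>i\<le>k. \<Sum>j\<le>k. cnj (a i) * toep r i j * a j)"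
      unfolding toep_pd_def lessThan_Suc_atMost using a0 by (auto dest!: spec[of _ a])
    then show "0 < P" unfolding split by (simp add: a0)
  }
  {
    assume "0 < P"
    show "toep_pd r (Suc k)"
      unfolding toep_pd_def lessThan_Suc_atMost
    proof (intro allI impI)
      fix v :: "nat \<Rightarrow> complex"
      assume nz: "\<exists>i<Suc k. v i \<noteq> 0"
      define w where "w i = v (Suc i) - v 0 * a (Suc i)" for i
      have form: "Re (\<Sum>i\<le>k. \<Sum>j\<le>k. cnj (v i) * toep r i j * v j) =
          (cmod (v 0))\<^sup>2 * P + Re (\<Sum>i<k. \<Sum>j<k. cnj (w i) * toep r i j * w j)"
        unfolding split w_def
        by (simp add: complex_norm_square[symmetric] mult.commute[of "cnj (v 0)"] flip: of_real_mult of_real_power)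
      show "0 < Re (\<Sum>i\<le>k. \<Sum>j\<le>k. cnj (v i) * toep r i j * v j)"
      proof (cases "\<exists>i<k. w i \<noteq> 0")
        case True
        then have "0 < Re (\<Sum>i<k. \<Sum>j<k. cnj (w i) * toep r i j * w j)"
          using assms(1) by (auto simp: toep_pd_def)
        then show ?thesis using form \<open>0 < P\<close> by (simp add: add_nonneg_pos)
      next
        \<comment> \<open>Here \<open>v\<close> is \<open>v 0\<close> times \<open>a\<close>, so it could only vanish at 0 by vanishing altogether.\<close>
        case False
        then have "v 0 \<noteq> 0"
          using nz by (auto simp: w_def less_Suc_eq_0_disj)
        then show ?thesis using form False \<open>0 < P\<close> by simp
      qed
    qed
  }
qed

text \<open>Truncation to \<open>j \<le> k\<close> is the appended zero of the first summand, and the case \<open>j = 0\<close> is the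
  prepended zero of the reversed vector.\<close>

definition levinson_step :: "nat \<Rightarrow> complex \<Rightarrow> (nat \<Rightarrow> complex) \<Rightarrow> nat \<Rightarrow> complex" where
  "levinson_step k c a j =
     (if j \<le> k then a j else 0) + (if j = 0 then 0 else c * cnj (a (Suc k - j)))"

text \<open>On the vector \<open>a\<close> with a zero appended, the matrix of size \<open>k + 2\<close> takes the value \<open>P\<close> in the
  first row, the value \<open>\<Delta> = \<Sum> r (k + 1 - j) a j\<close> in the last row and 0 in between; on its reversed
  conjugate it takes the conjugate values in the opposite order. The choice \<open>c P = - \<Delta>\<close> cancels the
  last row, and leaves \<open>P + c cnj \<Delta> = P (1 - |c|\<^sup>2)\<close> in the first.\<close>

lemma yule_walker_sol_levinson_step:
  assumes "yule_walker_sol r k a (complex_of_real P)" "cnj (r 0) = r 0"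
    and c: "c * complex_of_real P = - (\<Sum>j\<le>k. r (Suc k - j) * a j)"
  shows "yule_walker_sol r (Suc k) (levinson_step k c a) (complex_of_real (P * (1 - (cmod c)\<^sup>2)))"
proof -
  have a0: "a 0 = 1"
    and yw: "\<And>i. i \<le> k \<Longrightarrow> (\<Sum>j\<le>k. toep r i j * a j) = (if i = 0 then complex_of_real P else 0)"
    using assms(1) by (auto simp: yule_walker_sol_def)
  have last: "(\<Sum>j\<le>k. toep r (Suc k) j * a j) = - c * of_real P"
    unfolding minus_mult_left[symmetric] c minus_minus
    by (intro sum.cong refl) (simp add: toep_def)
  have row: "(\<Sum>j\<le>Suc k. toep r i j * levinson_step k c a j) =
      (\<Sum>j\<le>k. toep r i j * a j) + c * cnj (\<Sum>j\<le>k. toep r (Suc k - i) j * a j)" if "i \<le> Suc k" for i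
  proof -
    have "(\<Sum>j\<le>Suc k. toep r i j * levinson_step k c a j) =
        (\<Sum>j\<le>Suc k. toep r i j * (if j \<le> k then a j else 0)) +
        (\<Sum>j\<le>Suc k. toep r i j * (if j = 0 then 0 else c * cnj (a (Suc k - j))))"
      by (simp only: levinson_step_def distrib_left sum.distrib)
    also have "(\<Sum>j\<le>Suc k. toep r i j * (if j \<le> k then a j else 0)) = (\<Sum>j\<le>k. toep r i j * a j)"
      by simp
    also have "(\<Sum>j\<le>Suc k. toep r i j * (if j = 0 then 0 else c * cnj (a (Suc k - j)))) =
        (\<Sum>j\<le>k. toep r i (Suc j) * (c * cnj (a (k - j))))"
      by (simp add: sum.atMost_Suc_shift del: sum.atMost_Suc)
    also have "\<dots> = (\<Sum>j\<le>k. toep r i (Suc (k - j)) * (c * cnj (a j)))"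
      by (rule sum.reindex_bij_witness[of _ "\<lambda>j. k - j" "\<lambda>j. k - j"]) auto
    also have "\<dots> = (\<Sum>j\<le>k. c * cnj (toep r (Suc k - i) j * a j))"
    proof (intro sum.cong refl)
      \<comment> \<open>Reversing the order of both rows and columns transposes, that is, conjugates.\<close>
      fix j assume "j \<in> {..k}"
      then have "toep r i (Suc (k - j)) = cnj (toep r (Suc k - i) j)"
        using that toep_reflect[of "Suc k - i" "Suc k" j r] cnj_toep[of r "Suc k - i" j] assms(2)
        by (simp add: Suc_diff_le)
      then show "toep r i (Suc (k - j)) * (c * cnj (a j)) = c * cnj (toep r (Suc k - i) j * a j)"
        by simp
    qed
    finally show ?thesis by (simp add: sum_distrib_left)
  qed
  show ?thesis
    unfolding yule_walker_sol_def
  proof (intro conjI allI impI)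
    show "levinson_step k c a 0 = 1" by (simp add: levinson_step_def a0)
    fix i assume i: "i \<le> Suc k"
    consider "i = 0" | "0 < i" "i \<le> k" | "i = Suc k" using i by linarith
    then show "(\<Sum>j\<le>Suc k. toep r i j * levinson_step k c a j) =
        (if i = 0 then complex_of_real (P * (1 - (cmod c)\<^sup>2)) else 0)"
    proof cases
      case 1
      have "(complex_of_real (cmod c))\<^sup>2 = c * cnj c"
        using complex_norm_square[of c] by simp
      then show ?thesis
        unfolding row[OF i] using 1 yw[of 0] last by (simp add: algebra_simps)
    next
      case 2
      then show ?thesis unfolding row[OF i] using yw[of i] yw[of "Suc k - i"] by simp
    next
      case 3
      then show ?thesis unfolding row[OF i] using yw[of 0] last by simp
    qed
  qed
qed

section \<open>Symbols with prescribed reflection coefficients\<close>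

primrec levinson_poly :: "(nat \<Rightarrow> complex) \<Rightarrow> nat \<Rightarrow> nat \<Rightarrow> complex" where
  "levinson_poly \<mu> 0 = (\<lambda>j. if j = 0 then 1 else 0)"
| "levinson_poly \<mu> (Suc k) = levinson_step k (\<mu> (Suc k)) (levinson_poly \<mu> k)"

definition levinson_error :: "real \<Rightarrow> (nat \<Rightarrow> complex) \<Rightarrow> nat \<Rightarrow> real" where
  "levinson_error P0 \<mu> k = P0 * (\<Prod>i = 1..k. 1 - (cmod (\<mu> i))\<^sup>2)"

text \<open>The Levinson equation of order \<open>k + 1\<close> solved for its coefficient of highest index.\<close>

fun levinson_coeff :: "real \<Rightarrow> (nat \<Rightarrow> complex) \<Rightarrow> nat \<Rightarrow> complex" where
  "levinson_coeff P0 \<mu> 0 = complex_of_real P0"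
| "levinson_coeff P0 \<mu> (Suc k) = - \<mu> (Suc k) * complex_of_real (levinson_error P0 \<mu> k) -
     (\<Sum>j = 1..k. levinson_coeff P0 \<mu> (Suc k - j) * levinson_poly \<mu> k j)"

lemma levinson_poly_0 [simp]: "levinson_poly \<mu> k 0 = 1"
  by (induction k) (auto simp: levinson_step_def)

lemma levinson_poly_last: "1 \<le> k \<Longrightarrow> levinson_poly \<mu> k k = \<mu> k"
  by (cases k) (auto simp: levinson_step_def)

lemma levinson_error_Suc:
  "levinson_error P0 \<mu> (Suc k) = levinson_error P0 \<mu> k * (1 - (cmod (\<mu> (Suc k)))\<^sup>2)"
  by (simp add: levinson_error_def)

text \<open>The left side is the hypothesis of \<open>yule_walker_sol_levinson_step\<close>; its summand for \<open>j = 0\<close> is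
  \<open>r (k + 1)\<close>, because \<open>levinson_poly\<close> starts with 1.\<close>

lemma levinson_relation:
  assumes "\<And>j. j \<le> k \<Longrightarrow> r j = levinson_coeff P0 \<mu> j"
  shows "\<mu> (Suc k) * complex_of_real (levinson_error P0 \<mu> k) =
      - (\<Sum>j\<le>k. r (Suc k - j) * levinson_poly \<mu> k j) \<longleftrightarrow> r (Suc k) = levinson_coeff P0 \<mu> (Suc k)"
proof -
  have "(\<Sum>j\<le>k. r (Suc k - j) * levinson_poly \<mu> k j) =
      r (Suc k) + (\<Sum>j = 1..k. levinson_coeff P0 \<mu> (Suc k - j) * levinson_poly \<mu> k j)"
    by (auto simp: atMost_atLeast0 sum.atLeast_Suc_atMost intro!: sum.cong arg_cong2[where f = times] assms)
  then show ?thesis by (auto simp: algebra_simps eq_neg_iff_add_eq_0)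
qed

lemma yule_walker_sol_levinson_poly:
  assumes "\<And>j. j \<le> k \<Longrightarrow> r j = levinson_coeff P0 \<mu> j"
  shows "yule_walker_sol r k (levinson_poly \<mu> k) (complex_of_real (levinson_error P0 \<mu> k))"
  using assms
proof (induction k)
  case 0
  then show ?case by (simp add: yule_walker_sol_def toep_def levinson_error_def)
next
  case (Suc k)
  have "\<mu> (Suc k) * complex_of_real (levinson_error P0 \<mu> k) =
      - (\<Sum>j\<le>k. r (Suc k - j) * levinson_poly \<mu> k j)"
    using levinson_relation[of k r P0 \<mu>] Suc.prems by simp
  moreover have "cnj (r 0) = r 0" using Suc.prems[of 0] by simp
  ultimately show ?case
    unfolding levinson_error_Suc levinson_poly.simps
    using Suc by (intro yule_walker_sol_levinson_step) auto
qed

lemma levinson_error_pos: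
  assumes "0 < P0" "\<And>i. 1 \<le> i \<Longrightarrow> i \<le> k \<Longrightarrow> cmod (\<mu> i) < 1"
  shows "0 < levinson_error P0 \<mu> k"
  unfolding levinson_error_def using assms
  by (intro mult_pos_pos prod_pos) (auto simp: abs_square_less_1)

lemma toep_pd_levinson_coeff:
  assumes "\<And>j. j \<le> m \<Longrightarrow> r j = levinson_coeff P0 \<mu> j" "0 < P0"
    "\<And>i. 1 \<le> i \<Longrightarrow> i \<le> m \<Longrightarrow> cmod (\<mu> i) < 1"
  shows "toep_pd r (Suc m)"
proof -
  have "toep_pd r k" if "k \<le> Suc m" for k
    using that
  proof (induction k)
    case 0
    then show ?case by (simp add: toep_pd_def)
  next
    case (Suc k)
    have "yule_walker_sol r k (levinson_poly \<mu> k) (complex_of_real (levinson_error P0 \<mu> k))"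
      using Suc.prems assms(1) by (intro yule_walker_sol_levinson_poly) auto
    moreover have "0 < levinson_error P0 \<mu> k"
      using Suc.prems assms by (intro levinson_error_pos) auto
    ultimately show ?case
      using Suc toep_pd_Suc_iff assms(1)[of 0] by simp
  qed
  then show ?thesis by blast
qed

text \<open>Positivity makes the errors nonzero, so the Levinson equation can be solved for its multiplier \<open>c\<close>;
  the resulting solution ends in \<open>c\<close>, which identifies \<open>c\<close> with the given \<open>\<mu> (l + 1)\<close>. The premise on \<open>\<mu>\<close>
  is what uniqueness of Yule-Walker solutions provides for the reflection coefficients.\<close>

lemma levinson_coeff_of_toep_pd:
  assumes pd: "toep_pd r (Suc m)" and r0: "r 0 = complex_of_real P0"
    and \<mu>: "\<And>k a P. 1 \<le> k \<Longrightarrow> k \<le> m \<Longrightarrow> yule_walker_sol r k a P \<Longrightarrow> \<mu> k = a k"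
  shows "k \<le> m \<Longrightarrow> r k = levinson_coeff P0 \<mu> k"
proof (induction k rule: less_induct)
  case (less k)
  show ?case
  proof (cases k)
    case 0
    then show ?thesis by (simp add: r0)
  next
    case (Suc l)
    have IH: "r j = levinson_coeff P0 \<mu> j" if "j \<le> l" for j
      using less that Suc by simp
    have yw: "yule_walker_sol r l (levinson_poly \<mu> l) (complex_of_real (levinson_error P0 \<mu> l))"
      by (rule yule_walker_sol_levinson_poly) (rule IH)
    have "toep_pd r l" "toep_pd r (Suc l)"
      using toep_pd_mono[OF pd] less.prems Suc by auto
    then have pos: "0 < levinson_error P0 \<mu> l"
      using toep_pd_Suc_iff[OF _ yw] by (simp add: r0)
    define c where "c = - (\<Sum>j\<le>l. r (Suc l - j) * levinson_poly \<mu> l j) / complex_of_real (levinson_error P0 \<mu> l)"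
    have c: "c * complex_of_real (levinson_error P0 \<mu> l) = - (\<Sum>j\<le>l. r (Suc l - j) * levinson_poly \<mu> l j)"
      using pos by (simp add: c_def)
    have "\<mu> (Suc l) = levinson_step l c (levinson_poly \<mu> l) (Suc l)"
      using \<mu> yule_walker_sol_levinson_step[OF yw _ c] less.prems Suc r0 by simp
    then have "\<mu> (Suc l) = c" by (simp add: levinson_step_def)
    then show ?thesis
      using levinson_relation[of l r P0 \<mu>, OF IH] c Suc by simp
  qed
qed

text \<open>Consecutive errors are positive and have quotient \<open>1 - |\<mu> k|\<^sup>2\<close>.\<close>

lemma cmod_lt_1_of_toep_pd:
  assumes pd: "toep_pd r (Suc m)" and r: "\<And>j. j \<le> m \<Longrightarrow> r j = levinson_coeff P0 \<mu> j"
    and k: "1 \<le> k" "k \<le> m"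
  shows "cmod (\<mu> k) < 1"
proof -
  have pos: "0 < levinson_error P0 \<mu> l" if "l \<le> m" for l
    using toep_pd_Suc_iff[OF toep_pd_mono[OF pd] yule_walker_sol_levinson_poly[of l r P0 \<mu>]]
      toep_pd_mono[OF pd, of "Suc l"] that r r[of 0] by simp
  obtain l where l: "k = Suc l" using k by (cases k) auto
  have "0 < levinson_error P0 \<mu> l * (1 - (cmod (\<mu> k))\<^sup>2)"
    using pos[of k] k l by (simp add: levinson_error_Suc)
  then have "(cmod (\<mu> k))\<^sup>2 < 1"
    using pos[of l] k l by (simp add: zero_less_mult_iff)
  then show ?thesis by (simp add: abs_square_less_1)
qed

section \<open>Toeplitz matrices\<close>

definition toep_mat :: "(nat \<Rightarrow> complex) \<Rightarrow> nat \<Rightarrow> complex mat" where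
  "toep_mat r k = Matrix.mat k k (\<lambda>(i, j). toep r i j)"

lemma toep_mat_carrier [simp]: "toep_mat r k \<in> carrier_mat k k"
  by (simp add: toep_mat_def)

lemma toep_mat_index [simp]: "i < k \<Longrightarrow> j < k \<Longrightarrow> toep_mat r k $$ (i, j) = toep r i j"
  by (simp add: toep_mat_def)

lemma toep_mat_dim [simp]: "dim_row (toep_mat r k) = k" "dim_col (toep_mat r k) = k"
  by (simp_all add: toep_mat_def)

lemma corner_toep_mat: "k \<le> n \<Longrightarrow> corner (toep_mat r n) k = toep_mat r k"
  by (rule eq_matI) (auto simp: corner_def)

lemma toeplitz_matrix_eq_toep_mat: "toeplitz_matrix n e x = toep_mat (toeplitz_coeff e x) n"
  by (rule eq_matI) (auto simp: toeplitz_matrix_def toep_def)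

lemma toep_mat_mult_vec:
  "toep_mat r k *\<^sub>v Matrix.vec k v = Matrix.vec k (\<lambda>i. \<Sum>j<k. toep r i j * v j)"
  by (rule eq_vecI) (auto simp: scalar_prod_def atLeast0LessThan)

lemma mat_delete_toep_mat: "mat_delete (toep_mat r (Suc k)) 0 0 = toep_mat r k"
  by (rule eq_matI) (auto simp: mat_delete_def)

lemma toep_mat_form:
  "(toep_mat r k *\<^sub>v Matrix.vec k v) \<bullet>c Matrix.vec k v = (\<Sum>i<k. \<Sum>j<k. cnj (v i) * toep r i j * v j)"
  unfolding toep_mat_mult_vec
  by (simp add: scalar_prod_def atLeast0LessThan sum_distrib_right sum_distrib_left mult_ac)

lemma vec_as_function: "v \<in> carrier_vec k \<Longrightarrow> v = Matrix.vec k (vec_index v)"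
  by (intro eq_vecI) auto

lemma vec_eq_0_iff: "Matrix.vec k v = 0\<^sub>v k \<longleftrightarrow> (\<forall>i<k. v i = 0)"
  by (auto simp: Matrix.vec_eq_iff)

lemma positive_definite_toep_mat: "positive_definite (toep_mat r k) \<longleftrightarrow> toep_pd r k"
proof
  assume pd: "positive_definite (toep_mat r k)"
  show "toep_pd r k"
    unfolding toep_pd_def
  proof (intro allI impI)
    fix v :: "nat \<Rightarrow> complex"
    assume "\<exists>i<k. v i \<noteq> 0"
    then have "0 < Re ((toep_mat r k *\<^sub>v Matrix.vec k v) \<bullet>c Matrix.vec k v)"
      using pd unfolding positive_definite_def by (auto simp: vec_eq_0_iff)
    then show "0 < Re (\<Sum>i<k. \<Sum>j<k. cnj (v i) * toep r i j * v j)"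
      unfolding toep_mat_form .
  qed
next
  assume pd: "toep_pd r k"
  show "positive_definite (toep_mat r k)"
    unfolding positive_definite_def
  proof (intro ballI impI)
    fix v :: "complex Matrix.vec"
    assume "v \<in> carrier_vec (dim_col (toep_mat r k))" and nz: "v \<noteq> 0\<^sub>v (dim_col (toep_mat r k))"
    then have v: "v = Matrix.vec k (vec_index v)" by (intro vec_as_function) simp
    with nz have "\<exists>i<k. vec_index v i \<noteq> 0"
      using vec_eq_0_iff[of k "vec_index v"] by auto
    then have "0 < Re (\<Sum>i<k. \<Sum>j<k. cnj (vec_index v i) * toep r i j * vec_index v j)"
      using pd by (simp add: toep_pd_def)
    then show "0 < Re ((toep_mat r k *\<^sub>v v) \<bullet>c v)"
      using toep_mat_form[of r k "vec_index v"] v by simp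
  qed
qed

text \<open>The form vanishes on a kernel vector.\<close>

lemma det_toep_mat_nonzero:
  assumes "toep_pd r k"
  shows "Determinant.det (toep_mat r k) \<noteq> 0"
proof
  assume "Determinant.det (toep_mat r k) = 0"
  then obtain v where v: "v \<in> carrier_vec k" "v \<noteq> 0\<^sub>v k" "toep_mat r k *\<^sub>v v = 0\<^sub>v k"
    using det_0_iff_vec_prod_zero[OF toep_mat_carrier] by blast
  have "0 < Re ((toep_mat r k *\<^sub>v v) \<bullet>c v)"
    using assms v(1,2) unfolding positive_definite_toep_mat[symmetric] positive_definite_def
    by (metis toep_mat_dim(2))
  then show False using v(1) unfolding v(3) by simp
qed

lemma toep_mat_mult_yule_walker_sol:
  assumes "yule_walker_sol r k a P"
  shows "toep_mat r (Suc k) *\<^sub>v Matrix.vec (Suc k) a = P \<cdot>\<^sub>v unit_vec (Suc k) 0"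
  using assms unfolding toep_mat_mult_vec
  by (intro eq_vecI) (auto simp: yule_walker_sol_def lessThan_Suc_atMost less_Suc_eq_le simp del: sum.atMost_Suc)

text \<open>Multiply the Yule-Walker equation by the adjugate, whose first column consists of the cofactors of
  the first row.\<close>

lemma yule_walker_sol_cramer:
  assumes "yule_walker_sol r k a P" "j \<le> k"
  shows "Determinant.det (toep_mat r (Suc k)) * a j = P * cofactor (toep_mat r (Suc k)) 0 j"
proof -
  let ?A = "toep_mat r (Suc k)" and ?v = "Matrix.vec (Suc k) a"
  note adj = adj_mat[OF toep_mat_carrier[of r "Suc k"]]
  have "adj_mat ?A *\<^sub>v (P \<cdot>\<^sub>v unit_vec (Suc k) 0) = adj_mat ?A *\<^sub>v (?A *\<^sub>v ?v)"
    by (simp only: toep_mat_mult_yule_walker_sol[OF assms(1)])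
  also have "\<dots> = (adj_mat ?A * ?A) *\<^sub>v ?v"
    by (rule assoc_mult_mat_vec[symmetric, OF adj(1) toep_mat_carrier]) simp
  also have "\<dots> = Determinant.det ?A \<cdot>\<^sub>v ?v"
    unfolding adj(3) by (intro eq_vecI) (auto simp: row_smult)
  finally have "vec_index (adj_mat ?A *\<^sub>v (P \<cdot>\<^sub>v unit_vec (Suc k) 0)) j = vec_index (Determinant.det ?A \<cdot>\<^sub>v ?v) j"
    by simp
  moreover have "vec_index (adj_mat ?A *\<^sub>v (P \<cdot>\<^sub>v unit_vec (Suc k) 0)) j = P * (adj_mat ?A $$ (j, 0))"
    using assms(2) adj(1) by (simp add: scalar_prod_def unit_vec_def if_distrib cong: if_cong)
  ultimately show ?thesis
    using assms(2) by (simp add: adj_mat_def)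
qed

text \<open>The component \<open>j = 0\<close> of Cramer's rule: deleting the first row and column leaves a Toeplitz matrix of
  the same symbol.\<close>

lemma det_toep_mat_Suc:
  assumes "yule_walker_sol r k a P"
  shows "Determinant.det (toep_mat r (Suc k)) = P * Determinant.det (toep_mat r k)"
  using yule_walker_sol_cramer[OF assms, of 0] assms
  by (simp add: cofactor_def mat_delete_toep_mat yule_walker_sol_def)

text \<open>Any solution in the sense of \<open>yule_walker_sol\<close> has the determinant quotient as its error, and a
  nonsingular system has only one solution, so the definite description picks this one.\<close>

lemma reflection_coeff_eq:
  assumes sol: "yule_walker_sol r k a P" and pd: "toep_pd r n" and k: "k < n"
  shows "reflection_coeff (toep_mat r n) k = a k"
proof -
  let ?A = "toep_mat r (Suc k)" and ?v = "Matrix.vec (Suc k) a"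
  have c: "corner (toep_mat r n) (Suc k) = ?A" "corner (toep_mat r n) k = toep_mat r k"
    using k by (simp_all add: corner_toep_mat)
  have nz: "Determinant.det (toep_mat r j) \<noteq> 0" if "j \<le> n" for j
    using det_toep_mat_nonzero[OF toep_pd_mono[OF pd that]] .
  have P: "prediction_error (toep_mat r n) k = P"
    unfolding prediction_error_def c det_toep_mat_Suc[OF sol] using nz[of k] k by simp
  have sol': "?A *\<^sub>v ?v = P \<cdot>\<^sub>v unit_vec (Suc k) 0"
    by (rule toep_mat_mult_yule_walker_sol[OF sol])
  have "yule_walker (toep_mat r n) k = ?v"
    unfolding yule_walker_def P c
  proof (rule the_equality)
    show "?v \<in> carrier_vec (Suc k) \<and> vec_index ?v 0 = 1 \<and> ?A *\<^sub>v ?v = P \<cdot>\<^sub>v unit_vec (Suc k) 0"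
      using sol sol' by (simp add: yule_walker_sol_def)
    fix w assume w: "w \<in> carrier_vec (Suc k) \<and> vec_index w 0 = 1 \<and> ?A *\<^sub>v w = P \<cdot>\<^sub>v unit_vec (Suc k) 0"
    have v: "?v \<in> carrier_vec (Suc k)" by simp
    have "?A *\<^sub>v (w - ?v) = ?A *\<^sub>v w - ?A *\<^sub>v ?v"
      by (rule mult_minus_distrib_mat_vec[OF toep_mat_carrier]) (use w in auto)
    then have "?A *\<^sub>v (w - ?v) = 0\<^sub>v (Suc k)"
      using w sol' by simp
    then have "w - ?v = 0\<^sub>v (Suc k)"
      using nz[of "Suc k"] k det_0_iff_vec_prod_zero[OF toep_mat_carrier[of r "Suc k"]] w v
      by (meson Suc_leI minus_carrier_vec)
    then have "vec_index (w - ?v) i = 0" if "i \<le> k" for i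
      using that by simp
    then have "vec_index w i = a i" if "i \<le> k" for i
      using that by fastforce
    then show "w = ?v" using w by (intro eq_vecI) auto
  qed
  then show ?thesis by (simp add: reflection_coeff_def)
qed

lemma levinson_coeff_reflection_coeff:
  assumes "toep_pd r n" "r 0 = complex_of_real P0" "k < n"
  shows "r k = levinson_coeff P0 (reflection_coeff (toep_mat r n)) k"
  using levinson_coeff_of_toep_pd[of r "n - 1" P0 "reflection_coeff (toep_mat r n)" k]
    reflection_coeff_eq[OF _ assms(1)] assms by simp

text \<open>The component \<open>j = k\<close> of Cramer's rule, divided by the component \<open>j = 0\<close>.\<close>

lemma reflection_coeff_det:
  assumes pd: "toep_pd r n" and r0: "r 0 = complex_of_real P0" and k: "k < n"
  shows "reflection_coeff (toep_mat r n) k =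
    (-1) ^ k * (Determinant.det (mat_delete (toep_mat r (Suc k)) 0 k) / Determinant.det (toep_mat r k))"
proof -
  obtain a P where sol: "yule_walker_sol r k a P"
    using yule_walker_sol_levinson_poly[of k r P0 "reflection_coeff (toep_mat r n)"]
      levinson_coeff_reflection_coeff[OF pd r0] k by fastforce
  have nz: "Determinant.det (toep_mat r j) \<noteq> 0" if "j \<le> n" for j
    using det_toep_mat_nonzero[OF toep_pd_mono[OF pd that]] .
  have "P * (Determinant.det (toep_mat r k) * a k) =
      P * ((-1) ^ k * Determinant.det (mat_delete (toep_mat r (Suc k)) 0 k))"
    using yule_walker_sol_cramer[OF sol, of k] det_toep_mat_Suc[OF sol]
    by (simp add: cofactor_def mult_ac)
  moreover have "P \<noteq> 0"
    using nz[of "Suc k"] k det_toep_mat_Suc[OF sol] by auto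
  ultimately have "Determinant.det (toep_mat r k) * a k =
      (-1) ^ k * Determinant.det (mat_delete (toep_mat r (Suc k)) 0 k)"
    by (metis mult_cancel_left)
  then show ?thesis
    using reflection_coeff_eq[OF sol pd k] nz[of k] k by (simp add: field_simps)
qed

text \<open>Rows \<open>1, \<dots>, k\<close> of the Yule-Walker equation say that the matrix of size \<open>k\<close> maps the tail of \<open>a\<close> to
  the negative of the vector \<open>(r 1, \<dots>, r k)\<close>.\<close>

lemma mat_inverse_toep_mat_mult:
  assumes "yule_walker_sol r k a P" "toep_pd r k"
  shows "the (mat_inverse (toep_mat r k)) *\<^sub>v coeff_vec r k = Matrix.vec k (\<lambda>i. - a (Suc i))"
proof -
  let ?A = "toep_mat r k" and ?w = "Matrix.vec k (\<lambda>i. - a (Suc i))"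
  have "?A \<in> Units (ring_mat TYPE(complex) k ())"
    using det_non_zero_imp_unit[OF toep_mat_carrier det_toep_mat_nonzero[OF assms(2)]] .
  then obtain B where B: "mat_inverse ?A = Some B"
    using mat_inverse(1)[OF toep_mat_carrier[of r k], of "()"] by (cases "mat_inverse ?A") auto
  then have inv: "B * ?A = 1\<^sub>m k" "B \<in> carrier_mat k k"
    using mat_inverse(2)[OF toep_mat_carrier] by auto
  have "?A *\<^sub>v ?w = coeff_vec r k"
    unfolding toep_mat_mult_vec coeff_vec_def
  proof (rule eq_vecI)
    fix i assume "i < dim_vec (Matrix.vec k (\<lambda>i. r (Suc i)))"
    then have i: "i < k" by simp
    have "0 = (\<Sum>j\<le>k. toep r (Suc i) j * a j)"
      using assms(1) i by (auto simp: yule_walker_sol_def)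
    also have "\<dots> = r (Suc i) + (\<Sum>j<k. toep r i j * a (Suc j))"
      using assms(1) by (simp add: sum.atMost_shift yule_walker_sol_def toep_def[of r "Suc i" 0])
    finally show "vec_index (Matrix.vec k (\<lambda>i. \<Sum>j<k. toep r i j * - a (Suc j))) i =
        vec_index (Matrix.vec k (\<lambda>i. r (Suc i))) i"
      using i by (simp add: sum_negf eq_neg_iff_add_eq_0 neg_eq_iff_add_eq_0 add.commute)
  qed simp
  then have "B *\<^sub>v coeff_vec r k = B *\<^sub>v (?A *\<^sub>v ?w)" by simp
  also have "\<dots> = (B * ?A) *\<^sub>v ?w"
    by (rule assoc_mult_mat_vec[symmetric, OF inv(2) toep_mat_carrier]) simp
  finally show ?thesis using B inv by simp
qed

lemma exchange_mat_mult_vec: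
  "exchange_mat k *\<^sub>v Matrix.vec k w = Matrix.vec k (\<lambda>i. w (k - Suc i))"
proof (rule eq_vecI)
  fix i assume "i < dim_vec (Matrix.vec k (\<lambda>i. w (k - Suc i)))"
  then have i: "i < k" by simp
  have "vec_index (exchange_mat k *\<^sub>v Matrix.vec k w) i = (\<Sum>j<k. (if Suc (i + j) = k then 1 else 0) * w j)"
    using i by (simp add: exchange_mat_def scalar_prod_def atLeast0LessThan)
  also have "\<dots> = (\<Sum>j<k. if j = k - Suc i then w j else 0)"
    using i by (intro sum.cong) auto
  finally show "vec_index (exchange_mat k *\<^sub>v Matrix.vec k w) i = vec_index (Matrix.vec k (\<lambda>i. w (k - Suc i))) i"
    using i by simp
qed (simp add: exchange_mat_def)

text \<open>The right side is the correction term in the recursion for \<open>levinson_coeff\<close>; the exchange matrix produces the reversed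
  indexing of the convolution.\<close>

lemma exchange_form:
  assumes "yule_walker_sol r k a P" "toep_pd r k"
  shows "scalar_prod (coeff_vec r k)
      (exchange_mat k *\<^sub>v (the (mat_inverse (toep_mat r k)) *\<^sub>v coeff_vec r k)) =
    - (\<Sum>j = 1..k. r (Suc k - j) * a j)"
proof -
  have "scalar_prod (coeff_vec r k)
      (exchange_mat k *\<^sub>v (the (mat_inverse (toep_mat r k)) *\<^sub>v coeff_vec r k)) =
      (\<Sum>i<k. r (Suc i) * - a (Suc (k - Suc i)))"
    unfolding mat_inverse_toep_mat_mult[OF assms] exchange_mat_mult_vec
    by (simp add: scalar_prod_def coeff_vec_def atLeast0LessThan)
  also have "\<dots> = (\<Sum>j = 1..k. - (r (Suc k - j) * a j))"
    by (rule sum.reindex_bij_witness[of _ "\<lambda>j. k - j" "\<lambda>i. k - i"]) (auto simp: Suc_diff_Suc Suc_diff_le)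
  finally show ?thesis by (simp add: sum_negf)
qed

section \<open>The reflection map and its inverse\<close>

definition reflection_inverse ::
    "nat \<Rightarrow> (nat \<Rightarrow> 'm::finite) \<Rightarrow> real \<times> (complex^'m) \<Rightarrow> real \<times> (complex^'m)" where
  "reflection_inverse n e p =
     (fst p, \<chi> i. levinson_coeff (fst p) (\<lambda>k. snd p $ e k) (inv_into {1..n - 1} e i))"

lemma reflection_error_eq: "reflection_error e p = levinson_error (fst p) (\<lambda>k. snd p $ e k)"
  by (rule ext) (simp add: reflection_error_def levinson_error_def)

lemma toeplitz_coeff_0 [simp]: "toeplitz_coeff e x 0 = complex_of_real (fst x)"
  by (simp add: toeplitz_coeff_def)

text \<open>Matrices built from coordinates are Toeplitz and Hermitian by construction, so only positivity counts.\<close>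

lemma mem_toeplitz_domain_iff: "x \<in> toeplitz_domain n e \<longleftrightarrow> toep_pd (toeplitz_coeff e x) n"
proof -
  have "toeplitz (toep_mat (toeplitz_coeff e x) n)"
    by (auto simp: toeplitz_def)
  moreover have "hermitian (toep_mat (toeplitz_coeff e x) n)"
    by (subst hermitian_iff[OF toep_mat_carrier]) (auto simp: cnj_toep)
  ultimately show ?thesis
    by (simp add: toeplitz_domain_def toeplitz_hpd_def toeplitz_matrix_eq_toep_mat positive_definite_toep_mat)
qed

lemma open_reflection_codomain: "open (reflection_codomain :: (real \<times> (complex^'m::finite)) set)"
proof -
  have eq: "(reflection_codomain :: (real \<times> (complex^'m)) set) = {0<..} \<times> (\<Inter>i. {\<mu>. cmod (\<mu> $ i) < 1})"
    by (auto simp: reflection_codomain_def)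
  show ?thesis
    unfolding eq by (auto intro!: open_Times open_INT open_Collect_less continuous_intros)
qed

lemma smooth_on_levinson_poly:
  assumes "open S" "\<And>i. smooth_on S (\<lambda>p. \<mu> p i)"
  shows "smooth_on S (\<lambda>p. levinson_poly (\<mu> p) k j)"
proof (induction k arbitrary: j)
  case (Suc k)
  show ?case
    unfolding levinson_poly.simps levinson_step_def
    by (cases "j \<le> k"; cases "j = 0")
      (auto intro!: smooth_on_add smooth_on_mult smooth_on_cnj smooth_on_const assms Suc)
qed (simp add: smooth_on_const assms(1))

text \<open>As \<open>|\<mu>|\<^sup>2\<close> is \<open>\<mu>\<close> times its conjugate, the error is a polynomial in real-linear functions of \<open>\<mu>\<close>.\<close>

lemma smooth_on_levinson_error:
  assumes "open S" "smooth_on S P0" "\<And>i. smooth_on S (\<lambda>p. \<mu> p i)"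
  shows "smooth_on S (\<lambda>p. complex_of_real (levinson_error (P0 p) (\<mu> p) k))"
proof -
  have "complex_of_real (levinson_error (P0 p) (\<mu> p) k) =
      complex_of_real (P0 p) * (\<Prod>i = 1..k. 1 - \<mu> p i * cnj (\<mu> p i))" for p
    by (simp add: levinson_error_def complex_norm_square[symmetric])
  then show ?thesis
    using assms
    by (auto intro!: smooth_on_mult smooth_on_prod smooth_on_diff smooth_on_const smooth_on_cnj
        smooth_on_bounded_linear[OF _ bounded_linear_of_real])
qed

lemma smooth_on_levinson_coeff:
  assumes "open S" "smooth_on S P0" "\<And>i. smooth_on S (\<lambda>p. \<mu> p i)"
  shows "smooth_on S (\<lambda>p. levinson_coeff (P0 p) (\<mu> p) k)"
proof (induction k rule: less_induct)
  case (less k)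
  show ?case
  proof (cases k)
    case 0
    then show ?thesis
      using smooth_on_bounded_linear[OF assms(1) bounded_linear_of_real assms(2)] by simp
  next
    case (Suc l)
    show ?thesis
      unfolding Suc levinson_coeff.simps
      by (intro smooth_on_diff smooth_on_sum smooth_on_mult smooth_on_uminus
          smooth_on_levinson_error smooth_on_levinson_poly less assms) (use Suc in auto)
  qed
qed

text \<open>An equivalence, since the algorithm must also determine \<open>x\<close>: once the earlier
  coefficients agree, the step of the algorithm and the Levinson recursion prescribe the same value.\<close>

lemma levinson_coeff_algorithm:
  assumes r: "\<And>j. j < k \<Longrightarrow> r j = levinson_coeff P0 \<mu> j" and pd: "toep_pd r (k - 1)" and k: "2 \<le> k"
  shows "r k = - \<mu> k * complex_of_real (levinson_error P0 \<mu> (k - 1)) +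
      scalar_prod (coeff_vec r (k - 1))
        (exchange_mat (k - 1) *\<^sub>v (the (mat_inverse (toep_mat r (k - 1))) *\<^sub>v coeff_vec r (k - 1)))
    \<longleftrightarrow> r k = levinson_coeff P0 \<mu> k"
proof -
  obtain l where l: "k = Suc l" using k by (cases k) auto
  have "(\<Sum>j = 1..l. r (Suc l - j) * levinson_poly \<mu> l j) =
      (\<Sum>j = 1..l. levinson_coeff P0 \<mu> (Suc l - j) * levinson_poly \<mu> l j)"
  proof (intro sum.cong refl arg_cong2[where f = times] r)
    show "Suc l - j < k" if "j \<in> {1..l}" for j using that l by auto
  qed
  then show ?thesis
    using exchange_form[OF yule_walker_sol_levinson_poly[of l r P0 \<mu>]] r pd by (simp add: l)
qed

context
  fixes n :: nat and e :: "nat \<Rightarrow> 'm::finite"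
  assumes n: "2 \<le> n" and e: "bij_betw e {1..n - 1} (UNIV :: 'm set)"
begin

lemma inv_e: "1 \<le> k \<Longrightarrow> k < n \<Longrightarrow> inv_into {1..n - 1} e (e k) = k"
  using e by (intro inv_into_f_f) (auto simp: bij_betw_def)

lemma index_cases: obtains k where "1 \<le> k" "k < n" "i = e k"
proof -
  have "i \<in> e ` {1..n - 1}" using e by (simp add: bij_betw_def)
  then show ?thesis using that n by fastforce
qed

lemma toeplitz_coeff_eqI:
  assumes "\<And>k. k < n \<Longrightarrow> toeplitz_coeff e x k = toeplitz_coeff e y k"
  shows "x = y"
proof -
  have "snd x $ i = snd y $ i" for i
    using assms by (cases i rule: index_cases) (force simp: toeplitz_coeff_def)
  moreover have "fst x = fst y" using assms[of 0] n by simp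
  ultimately show ?thesis by (simp add: prod_eq_iff Finite_Cartesian_Product.vec_eq_iff)
qed

lemma toeplitz_coeff_reflection_inverse:
  "k < n \<Longrightarrow> toeplitz_coeff e (reflection_inverse n e p) k = levinson_coeff (fst p) (\<lambda>k. snd p $ e k) k"
  by (auto simp: toeplitz_coeff_def reflection_inverse_def inv_e simp del: One_nat_def)

lemma reflection_map_component:
  assumes "1 \<le> k" "k < n"
  shows "snd (reflection_map n e x) $ e k = reflection_coeff (toep_mat (toeplitz_coeff e x) n) k"
  using assms by (simp add: reflection_map_def inv_e toeplitz_matrix_eq_toep_mat del: One_nat_def)

text \<open>The coefficients of a positive definite matrix are recovered from its reflection coefficients; this is
  injectivity of the reflection map.\<close>

lemma toeplitz_coeff_reflection_map:
  assumes x: "x \<in> toeplitz_domain n e" and k: "k < n"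
  shows "toeplitz_coeff e x k = levinson_coeff (fst x) (\<lambda>k. snd (reflection_map n e x) $ e k) k"
proof (rule levinson_coeff_of_toep_pd[of _ "n - 1"])
  have pd: "toep_pd (toeplitz_coeff e x) n" using x by (simp add: mem_toeplitz_domain_iff)
  then show "toep_pd (toeplitz_coeff e x) (Suc (n - 1))" using n by simp
  show "snd (reflection_map n e x) $ e l = a l"
    if "1 \<le> l" "l \<le> n - 1" "yule_walker_sol (toeplitz_coeff e x) l a P" for l a P
    using reflection_coeff_eq[OF that(3) pd] reflection_map_component[of l x] that n by simp
qed (use k in auto)

lemma reflection_map_in_codomain:
  assumes x: "x \<in> toeplitz_domain n e"
  shows "reflection_map n e x \<in> reflection_codomain"
proof -
  have pd: "toep_pd (toeplitz_coeff e x) (Suc (n - 1))"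
    using x n by (simp add: mem_toeplitz_domain_iff)
  have "cmod (snd (reflection_map n e x) $ i) < 1" for i
  proof (cases i rule: index_cases)
    case (1 k)
    then show ?thesis
      using cmod_lt_1_of_toep_pd[OF pd, of "fst x" "\<lambda>k. snd (reflection_map n e x) $ e k" k]
        toeplitz_coeff_reflection_map[OF x] by simp
  qed
  moreover have "0 < fst x"
  proof -
    have "toep_pd (toeplitz_coeff e x) 1" using toep_pd_mono[OF pd] by simp
    then show ?thesis by (auto simp: toep_pd_def toep_def dest: spec[of _ "\<lambda>_. 1"])
  qed
  ultimately show ?thesis
    by (simp add: reflection_codomain_def reflection_map_def)
qed

lemma reflection_inverse_reflection_map:
  assumes "x \<in> toeplitz_domain n e"
  shows "reflection_inverse n e (reflection_map n e x) = x"
proof (rule toeplitz_coeff_eqI)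
  fix k assume k: "k < n"
  have "fst (reflection_map n e x) = fst x" by (simp add: reflection_map_def)
  then show "toeplitz_coeff e (reflection_inverse n e (reflection_map n e x)) k = toeplitz_coeff e x k"
    using k toeplitz_coeff_reflection_inverse[OF k, of "reflection_map n e x"]
      toeplitz_coeff_reflection_map[OF assms k] by simp
qed

lemma reflection_inverse_in_domain:
  assumes "p \<in> reflection_codomain"
  shows "reflection_inverse n e p \<in> toeplitz_domain n e"
proof -
  have "toep_pd (toeplitz_coeff e (reflection_inverse n e p)) (Suc (n - 1))"
    by (rule toep_pd_levinson_coeff[of _ _ "fst p" "\<lambda>k. snd p $ e k"])
      (use assms n toeplitz_coeff_reflection_inverse in \<open>auto simp: reflection_codomain_def\<close>)
  then show ?thesis using n by (simp add: mem_toeplitz_domain_iff)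
qed

lemma reflection_map_reflection_inverse:
  assumes p: "p \<in> reflection_codomain"
  shows "reflection_map n e (reflection_inverse n e p) = p"
proof -
  let ?x = "reflection_inverse n e p"
  have pd: "toep_pd (toeplitz_coeff e ?x) n"
    using reflection_inverse_in_domain[OF p] by (simp add: mem_toeplitz_domain_iff)
  have "snd (reflection_map n e ?x) $ i = snd p $ i" for i
  proof (cases i rule: index_cases)
    case (1 k)
    have "yule_walker_sol (toeplitz_coeff e ?x) k (levinson_poly (\<lambda>k. snd p $ e k) k)
        (complex_of_real (levinson_error (fst p) (\<lambda>k. snd p $ e k) k))"
      by (rule yule_walker_sol_levinson_poly) (use 1 toeplitz_coeff_reflection_inverse in simp)
    then show ?thesis
      using 1 reflection_coeff_eq[OF _ pd] reflection_map_component[of k ?x] levinson_poly_last[of k]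
      by simp
  qed
  then show ?thesis
    by (simp add: prod_eq_iff Finite_Cartesian_Product.vec_eq_iff reflection_map_def reflection_inverse_def)
qed

lemma bij_betw_reflection_map:
  "bij_betw (reflection_map n e) (toeplitz_domain n e) reflection_codomain"
  by (rule bij_betw_byWitness[where f' = "reflection_inverse n e"])
    (auto simp: reflection_inverse_reflection_map reflection_map_reflection_inverse
      reflection_map_in_codomain reflection_inverse_in_domain)

lemma inv_into_reflection_map:
  assumes "p \<in> reflection_codomain"
  shows "inv_into (toeplitz_domain n e) (reflection_map n e) p = reflection_inverse n e p"
  using assms bij_betw_reflection_map
  by (intro inv_into_f_eq) (auto simp: bij_betw_def reflection_map_reflection_inverse reflection_inverse_in_domain)

lemma smooth_on_reflection_inverse: "smooth_on reflection_codomain (reflection_inverse n e)"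
  unfolding reflection_inverse_def
  by (intro smooth_on_Pair smooth_on_vec_lambda smooth_on_levinson_coeff open_reflection_codomain
      smooth_on_bounded_linear[OF _ bounded_linear_fst]
      smooth_on_bounded_linear[OF _ bounded_linear_compose[OF bounded_linear_vec_nth bounded_linear_snd]]
      smooth_on_id)

text \<open>The domain is the image of an open set under the injective continuous map
  \<open>reflection_inverse\<close> between spaces of equal dimension, so invariance of domain applies.\<close>

lemma open_toeplitz_domain: "open (toeplitz_domain n e)"
proof -
  have "toeplitz_domain n e = reflection_inverse n e ` reflection_codomain"
    using reflection_inverse_reflection_map reflection_map_in_codomain reflection_inverse_in_domain
    by (force simp: image_iff)
  moreover have "open (reflection_inverse n e ` reflection_codomain)"
  proof (rule invariance_of_domain)
    show "continuous_on reflection_codomain (reflection_inverse n e)"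
      using smooth_on_reflection_inverse unfolding smooth_on_def
      by (metis higher_differentiable_on.simps(1))
    show "inj_on (reflection_inverse n e) reflection_codomain"
      by (rule inj_on_inverseI) (rule reflection_map_reflection_inverse)
  qed (rule open_reflection_codomain)
  ultimately show ?thesis by simp
qed

lemma reflection_map_det:
  assumes x: "x \<in> toeplitz_domain n e" and k: "1 \<le> k" "k < n"
  defines "r \<equiv> toeplitz_coeff e x"
  shows "snd (reflection_map n e x) $ e k =
    (-1) ^ k * (Determinant.det (mat_delete (toep_mat r (Suc k)) 0 k) / Determinant.det (toep_mat r k))"
  using reflection_coeff_det[of r n "fst x" k] x k reflection_map_component[of k x]
  by (simp add: r_def mem_toeplitz_domain_iff)

text \<open>Components are quotients of determinants of matrices with real-linear entries, and the
  denominators do not vanish on positive definite matrices.\<close>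

lemma smooth_on_reflection_map: "smooth_on (toeplitz_domain n e) (reflection_map n e)"
proof -
  let ?S = "toeplitz_domain n e" and ?M = "\<lambda>x k. toep_mat (toeplitz_coeff e x) k"
  note S = open_toeplitz_domain
  have coeff: "smooth_on ?S (\<lambda>x. toeplitz_coeff e x k)" for k
    unfolding toeplitz_coeff_def
    by (cases "k = 0")
      (auto intro!: S smooth_on_id smooth_on_bounded_linear[OF _ bounded_linear_compose[OF bounded_linear_of_real bounded_linear_fst]]
        smooth_on_bounded_linear[OF _ bounded_linear_compose[OF bounded_linear_vec_nth bounded_linear_snd]])
  have entry: "smooth_on ?S (\<lambda>x. toep (toeplitz_coeff e x) i j)" for i j
    unfolding toep_def by (cases "j \<le> i") (auto intro!: smooth_on_cnj S coeff)
  have det: "smooth_on ?S (\<lambda>x. Determinant.det (?M x k))" for k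
    by (rule smooth_on_det[OF S, of _ k]) (auto intro: entry)
  have minor: "smooth_on ?S (\<lambda>x. Determinant.det (mat_delete (?M x (Suc k)) 0 k))" for k
    by (rule smooth_on_det[OF S, of _ k]) (auto simp: mat_delete_def intro: entry)
  have comp: "smooth_on ?S (\<lambda>x. snd (reflection_map n e x) $ i)" for i
  proof (cases i rule: index_cases)
    case (1 k)
    have "Determinant.det (?M x k) \<noteq> 0" if "x \<in> ?S" for x
      using that 1 toep_pd_mono[of _ n k] by (intro det_toep_mat_nonzero) (simp add: mem_toeplitz_domain_iff)
    then have "smooth_on ?S (\<lambda>x. (-1) ^ k *
        (Determinant.det (mat_delete (?M x (Suc k)) 0 k) / Determinant.det (?M x k)))"
      by (intro smooth_on_mult smooth_on_divide smooth_on_const S det minor)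
    then show ?thesis
      by (rule smooth_on_cong[OF S]) (use reflection_map_det 1 in auto)
  qed
  have "smooth_on ?S (\<lambda>x. (fst x, \<chi> i. snd (reflection_map n e x) $ i))"
    by (intro smooth_on_Pair smooth_on_vec_lambda S comp smooth_on_id
        smooth_on_bounded_linear[OF _ bounded_linear_fst])
  then show ?thesis
    by (rule smooth_on_cong[OF S]) (simp add: reflection_map_def)
qed

lemma diffeomorphism_reflection_map:
  "diffeomorphism (toeplitz_domain n e) reflection_codomain (reflection_map n e)"
  unfolding diffeomorphism_def
  using smooth_on_cong[OF open_reflection_codomain smooth_on_reflection_inverse] inv_into_reflection_map
  by (auto simp: open_toeplitz_domain open_reflection_codomain bij_betw_reflection_map smooth_on_reflection_map)

text \<open>Both sides say that the coefficients of \<open>x\<close> agree with \<open>levinson_coeff\<close> below \<open>n\<close>. From the algorithm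
  this follows by strong induction: at step \<open>k\<close> the matrix of size \<open>k - 1\<close> is already known to be that
  of the inverse image, hence positive definite, which makes the inverse in the formula meaningful.\<close>

lemma reflection_inverse_algorithm:
  assumes p: "p \<in> reflection_codomain"
  defines "\<mu> \<equiv> \<lambda>k. snd p $ e k" and "P \<equiv> \<lambda>k. complex_of_real (reflection_error e p k)"
  shows "x = reflection_inverse n e p \<longleftrightarrow>
    (let r = toeplitz_coeff e x in
       r 0 = P 0 \<and> r 1 = - P 0 * \<mu> 1 \<and>
       (\<forall>k\<in>{2..n - 1}. r k = - \<mu> k * P (k - 1) +
          scalar_prod (coeff_vec r (k - 1))
            (exchange_mat (k - 1) *\<^sub>v (the (mat_inverse (toep_mat r (k - 1))) *\<^sub>v coeff_vec r (k - 1)))))"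
    (is "_ \<longleftrightarrow> ?alg")
proof -
  define r where "r = toeplitz_coeff e x"
  define c where "c = levinson_coeff (fst p) \<mu>"
  have eq: "x = reflection_inverse n e p \<longleftrightarrow> (\<forall>k<n. r k = c k)"
    using toeplitz_coeff_reflection_inverse[of _ p] toeplitz_coeff_eqI[of x "reflection_inverse n e p"]
    by (auto simp: r_def c_def \<mu>_def)
  have P: "P k = complex_of_real (levinson_error (fst p) \<mu> k)" for k
    by (simp add: P_def reflection_error_eq \<mu>_def)
  have c01: "c 0 = P 0" "c 1 = - P 0 * \<mu> 1"
    by (simp_all add: c_def P levinson_error_def)
  have step: "r k = - \<mu> k * P (k - 1) +
      scalar_prod (coeff_vec r (k - 1))
        (exchange_mat (k - 1) *\<^sub>v (the (mat_inverse (toep_mat r (k - 1))) *\<^sub>v coeff_vec r (k - 1)))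
      \<longleftrightarrow> r k = c k" if "\<And>j. j < k \<Longrightarrow> r j = c j" "2 \<le> k" for k
  proof -
    \<comment> \<open>The coefficients with index up to \<open>k - 2\<close> fill a matrix of size \<open>k - 1\<close>.\<close>
    have "toep_pd r (Suc (k - 2))"
      by (rule toep_pd_levinson_coeff[of _ _ "fst p" \<mu>])
        (use p that in \<open>auto simp: c_def \<mu>_def reflection_codomain_def\<close>)
    then have "toep_pd r (k - 1)" using that(2) by (simp add: numeral_2_eq_2 Suc_diff_Suc)
    then show ?thesis
      using levinson_coeff_algorithm[of k r "fst p" \<mu>] that by (simp add: c_def P)
  qed
  have "?alg \<longleftrightarrow> (\<forall>k<n. r k = c k)"
  proof
    assume all: "\<forall>k<n. r k = c k"
    have "r k = - \<mu> k * P (k - 1) +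
        scalar_prod (coeff_vec r (k - 1))
          (exchange_mat (k - 1) *\<^sub>v (the (mat_inverse (toep_mat r (k - 1))) *\<^sub>v coeff_vec r (k - 1)))"
      if "k \<in> {2..n - 1}" for k
      using step[of k] all that by auto
    then show ?alg
      using all n c01 unfolding Let_def r_def[symmetric] by simp
  next
    assume alg: ?alg
    have "r k = c k" if "k < n" for k
      using that
    proof (induction k rule: less_induct)
      case (less k)
      consider "k = 0" | "k = 1" | "2 \<le> k" by linarith
      then show ?case
      proof cases
        case 3
        then show ?thesis
          using alg less step[of k] unfolding Let_def r_def[symmetric] by simp
      qed (use alg c01 in \<open>auto simp: Let_def r_def\<close>)
    qed
    then show "\<forall>k<n. r k = c k" by blast
  qed
  with eq show ?thesis by simp
qed

end

theorem proposition5: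
  fixes n :: nat and e :: "nat \<Rightarrow> 'm::finite"
  assumes "2 \<le> n"
    and "bij_betw e {1..n - 1} (UNIV :: 'm set)"
  shows "diffeomorphism (toeplitz_domain n e) reflection_codomain (reflection_map n e)
    \<and> (\<forall>x\<in>toeplitz_domain n e.
         let R = corner (toeplitz_matrix n e x); (P0, \<mu>) = reflection_map n e x in
           complex_of_real P0 = toeplitz_coeff e x 0
         \<and> (\<forall>k\<in>{1..n - 1}. \<mu> $ e k =
              (-1) ^ k * (Determinant.det (mat_delete (R (k + 1)) 0 k) / Determinant.det (R k))))
    \<and> (\<forall>p\<in>reflection_codomain. \<forall>x.
         x = inv_into (toeplitz_domain n e) (reflection_map n e) p \<longleftrightarrow>
         (let r = toeplitz_coeff e x; R = corner (toeplitz_matrix n e x);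
              P = (\<lambda>k. complex_of_real (reflection_error e p k)); \<mu> = (\<lambda>k. snd p $ e k) in
           r 0 = P 0
         \<and> r 1 = - P 0 * \<mu> 1
         \<and> (\<forall>k\<in>{2..n - 1}. r k = - \<mu> k * P (k - 1) +
              scalar_prod (coeff_vec r (k - 1))
                (exchange_mat (k - 1) *\<^sub>v
                  (the (mat_inverse (R (k - 1))) *\<^sub>v coeff_vec r (k - 1))))))"
proof (intro conjI ballI allI)
  note n = assms(1) and e = assms(2)
  show "diffeomorphism (toeplitz_domain n e) reflection_codomain (reflection_map n e)"
    by (rule diffeomorphism_reflection_map[OF assms])
  show "let R = corner (toeplitz_matrix n e x); (P0, \<mu>) = reflection_map n e x in
           complex_of_real P0 = toeplitz_coeff e x 0
         \<and> (\<forall>k\<in>{1..n - 1}. \<mu> $ e k =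
              (-1) ^ k * (Determinant.det (mat_delete (R (k + 1)) 0 k) / Determinant.det (R k)))"
    if x: "x \<in> toeplitz_domain n e" for x
  proof -
    have "fst (reflection_map n e x) = fst x" by (simp add: reflection_map_def)
    then show ?thesis
      using reflection_map_det[OF assms x] n
      by (auto simp: Let_def case_prod_unfold toeplitz_matrix_eq_toep_mat corner_toep_mat)
  qed
  show "x = inv_into (toeplitz_domain n e) (reflection_map n e) p \<longleftrightarrow>
         (let r = toeplitz_coeff e x; R = corner (toeplitz_matrix n e x);
              P = (\<lambda>k. complex_of_real (reflection_error e p k)); \<mu> = (\<lambda>k. snd p $ e k) in
           r 0 = P 0
         \<and> r 1 = - P 0 * \<mu> 1
         \<and> (\<forall>k\<in>{2..n - 1}. r k = - \<mu> k * P (k - 1) +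
              scalar_prod (coeff_vec r (k - 1))
                (exchange_mat (k - 1) *\<^sub>v
                  (the (mat_inverse (R (k - 1))) *\<^sub>v coeff_vec r (k - 1)))))"
    if p: "p \<in> reflection_codomain" for p x
  proof -
    have "corner (toeplitz_matrix n e x) (k - 1) = toep_mat (toeplitz_coeff e x) (k - 1)"
      if "k \<in> {2..n - 1}" for k
      unfolding toeplitz_matrix_eq_toep_mat using that by (intro corner_toep_mat) auto
    then show ?thesis
      unfolding inv_into_reflection_map[OF assms p] reflection_inverse_algorithm[OF assms p, of x] Let_def
      by (simp cong: ball_cong_simp)
  qed
qed

end
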